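(* For all $s,t\in[0,1]$, we have $$\lim_{N\to\infty}N\left(\min(s,t)-st-\sum_{k=1}^N\frac{2\sin(k\pi s)\sin(k\pi t)}{k^2\pi^2}\right)=\begin{cases}\frac{1}{\pi^2} & \text{if }s=t\text{ and }t\in(0,1),\\ 0 & \text{otherwise.}\end{cases}$$
   Context: The limit is taken over positive integers $N$. *)

theory Defs
  imports "HOL-Analysis.Analysis"
begin

end

theory Submission
  imports Defs
begin

text \<open>
  Up to the factor \<open>pi\<^sup>2\<close>, the \<open>k\<close>-th summand is a difference of terms \<open>cos (k x) / k\<^sup>2\<close> with
  \<open>x = pi |s - t|\<close> and \<open>x = pi (s + t)\<close>, and \<open>min s t - s t\<close> is the corresponding difference of
  values of \<open>(\<Sum>k. cos (k x) / k\<^sup>2) = pi\<^sup>2 / 6 - pi x / 2 + x\<^sup>2 / 4\<close> for \<open>x \<in> [0, 2 pi]\<close>. So only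
  the tails of this series matter: \<open>N\<close> times the tail tends to \<open>1\<close> if \<open>x\<close> is a multiple of
  \<open>2 pi\<close>; otherwise summation by parts shows that the tail is \<open>O(1 / N\<^sup>2)\<close>.
\<close>

section \<open>Cosine sums, a telescoping estimate and the Dirichlet kernel\<close>

definition cos_psum :: "nat \<Rightarrow> real \<Rightarrow> real" where
  "cos_psum N x = (\<Sum>k=1..N. cos (real k * x) / (real k)\<^sup>2)"

text \<open>This is \<open>pi\<^sup>2\<close> times the second Bernoulli polynomial at
  \<open>x / (2 * pi)\<close>.\<close>

definition cos_limit :: "real \<Rightarrow> real" where
  "cos_limit x = pi\<^sup>2 / 6 - pi * x / 2 + x\<^sup>2 / 4"

text \<open>Adding the step bounds gives \<open>\<bar>u M - u n\<bar> \<le> v n - v M\<close>; then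
  let \<open>M\<close> tend to infinity. Both tail estimates below get their rate of convergence
  this way.\<close>

lemma dist_limit_le_telescope:
  fixes u v :: "nat \<Rightarrow> real"
  assumes step: "\<And>n. n \<ge> m \<Longrightarrow> \<bar>u (Suc n) - u n\<bar> \<le> v n - v (Suc n)"
    and u: "u \<longlonglongrightarrow> L" and v: "v \<longlonglongrightarrow> 0" and n: "n \<ge> m"
  shows "\<bar>L - u n\<bar> \<le> v n"
proof -
  have *: "\<bar>u M - u n\<bar> \<le> v n - v M" if "M \<ge> n" for M
    using that
  proof (induction M rule: dec_induct)
    case (step M)
    then show ?case using assms(1)[of M] n by linarith
  qed auto
  have "(\<lambda>M. \<bar>u M - u n\<bar>) \<longlonglongrightarrow> \<bar>L - u n\<bar>"
    by (intro tendsto_intros u)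
  moreover have "(\<lambda>M. v n - v M) \<longlonglongrightarrow> v n - 0"
    by (intro tendsto_intros v)
  ultimately show ?thesis
    using * LIMSEQ_le[of "\<lambda>M. \<bar>u M - u n\<bar>" "\<bar>L - u n\<bar>" "\<lambda>M. v n - v M" "v n - 0"]
    by (metis diff_zero)
qed

text \<open>The factor \<open>2 * sin (x / 2)\<close> turns each cosine into a difference of sines
  at neighbouring half-integer frequencies, so the sum telescopes.\<close>

lemma dirichlet_kernel:
  fixes x :: real
  shows "2 * sin (x / 2) * (1 / 2 + (\<Sum>k=1..N. cos (real k * x))) = sin ((real N + 1 / 2) * x)"
proof (induction N)
  case (Suc N)
  have "sin (real (Suc N) * x + x / 2) - sin (real (Suc N) * x - x / 2) = 2 * sin (x / 2) * cos (real (Suc N) * x)"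
    by (simp only: sin_add sin_diff) simp
  moreover have "real (Suc N) * x + x / 2 = (real (Suc N) + 1 / 2) * x"
    and "real (Suc N) * x - x / 2 = (real N + 1 / 2) * x"
    by (simp_all add: algebra_simps)
  ultimately have "sin ((real (Suc N) + 1 / 2) * x) - sin ((real N + 1 / 2) * x)
      = 2 * sin (x / 2) * cos (real (Suc N) * x)"
    by (simp only:)
  with Suc show ?case by (simp add: algebra_simps)
qed auto

lemma tendsto_inverse_square: "(\<lambda>n. c / (real n)\<^sup>2) \<longlonglongrightarrow> 0"
proof -
  have "(\<lambda>n. c * (1 / real n * (1 / real n))) \<longlonglongrightarrow> c * (0 * 0)"
    by (intro tendsto_intros lim_1_over_n)
  then show ?thesis by (simp add: power2_eq_square)
qed

section \<open>The value of the cosine series on \<open>[0, 2 pi]\<close>\<close>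

lemma cos_psum_0_tendsto: "(\<lambda>N. cos_psum N 0) \<longlonglongrightarrow> pi\<^sup>2 / 6"
proof -
  have "(\<lambda>N. \<Sum>k<N. 1 / (real k + 1)\<^sup>2) \<longlonglongrightarrow> pi\<^sup>2 / 6"
    using inverse_squares_sums by (simp add: sums_def add.commute)
  moreover have "(\<Sum>k<N. 1 / (real k + 1)\<^sup>2) = cos_psum N 0" for N
    unfolding cos_psum_def by (induction N) (simp_all add: add.commute)
  ultimately show ?thesis by simp
qed

text \<open>Convergence is uniform by the M-test. Continuity of the limit will carry its value from
  the open interval to the endpoints.\<close>

lemma cos_psum_continuous_limit:
  obtains C where "continuous_on UNIV C" "\<And>x. (\<lambda>N. cos_psum N x) \<longlonglongrightarrow> C x"
proof -
  define C where "C x = (\<Sum>k. cos (real (Suc k) * x) / (real (Suc k))\<^sup>2)" for x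
  have eq: "(\<Sum>k<N. cos (real (Suc k) * x) / (real (Suc k))\<^sup>2) = cos_psum N x" for N x
    unfolding cos_psum_def by (induction N) auto
  have "uniform_limit UNIV (\<lambda>N x. \<Sum>k<N. cos (real (Suc k) * x) / (real (Suc k))\<^sup>2) C sequentially"
    unfolding C_def
  proof (rule Weierstrass_m_test)
    show "summable (\<lambda>n. 1 / (real (Suc n))\<^sup>2)"
      using sums_summable[OF inverse_squares_sums] by (simp add: add.commute)
  qed (auto simp: divide_right_mono)
  then have lim: "uniform_limit UNIV cos_psum C sequentially"
    by (simp only: eq)
  have "continuous_on UNIV C"
    by (rule uniform_limit_theorem[OF _ lim])
      (auto simp: cos_psum_def intro!: always_eventually continuous_intros)
  moreover have "(\<lambda>N. cos_psum N x) \<longlonglongrightarrow> C x" for x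
    using tendsto_uniform_limitI[OF lim] by simp
  ultimately show ?thesis using that by blast
qed

text \<open>The function \<open>sin (x / 2)\<close> increases up to \<open>pi\<close> and is
  symmetric about \<open>pi\<close>. The bound keeps the denominator of the Dirichlet kernel away
  from zero.\<close>

lemma sin_half_ge:
  fixes a x :: real
  assumes "0 \<le> a" "a \<le> x" "x \<le> 2 * pi - a"
  shows "sin (a / 2) \<le> sin (x / 2)"
proof (cases "x \<le> pi")
  case True
  then show ?thesis using assms by (intro sin_monotone_2pi_le) auto
next
  case False
  have "sin (a / 2) \<le> sin (pi - x / 2)"
    using False assms by (intro sin_monotone_2pi_le) auto
  then show ?thesis by simp
qed

text \<open>
  The error \<open>(pi - x) / 2 - (\<Sum>k=1..N. sin (k x) / k)\<close> vanishes at \<open>pi\<close> and has derivative minus the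
  Dirichlet kernel; adding the first term of a partial integration makes the derivative \<open>O(1 / N)\<close>.
\<close>

lemma sawtooth_error_bound:
  fixes a x :: real
  assumes a: "0 < a" and x: "x \<in> {a..2 * pi - a}"
  shows "\<bar>(pi - x) / 2 - (\<Sum>k=1..N. sin (real k * x) / real k)\<bar>
           \<le> (pi / (2 * (sin (a / 2))\<^sup>2) + 1 / sin (a / 2)) / (2 * real N + 1)"
proof -
  define \<sigma> where "\<sigma> = sin (a / 2)"
  \<comment> \<open>\<open>c / 2 = N + 1 / 2\<close> is the frequency in the Dirichlet
    kernel.\<close>
  define c where "c = 2 * real N + 1"
  define g where "g y = (pi - y) / 2 - (\<Sum>k=1..N. sin (real k * y) / real k)" for y
  define h where "h y = g y - cos (c / 2 * y) / (c * sin (y / 2))" for y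
  \<comment> \<open>Differentiating the cosine in the correction term cancels the derivative of
    \<open>g\<close>; only the contribution of \<open>1 / sin (y / 2)\<close> is left.\<close>
  define h' where "h' y = cos (c / 2 * y) * cos (y / 2) / (2 * c * (sin (y / 2))\<^sup>2)" for y
  have c: "c > 0" by (simp add: c_def)
  have \<sigma>: "\<sigma> > 0" unfolding \<sigma>_def using a x by (intro sin_gt_zero) auto
  have sin_ge: "sin (y / 2) \<ge> \<sigma>" if "y \<in> {a..2 * pi - a}" for y
    unfolding \<sigma>_def using a that by (intro sin_half_ge) auto
  have der: "(h has_field_derivative h' y) (at y within {a..2 * pi - a})" if y: "y \<in> {a..2 * pi - a}" for y
  proof -
    have s: "sin (y / 2) > 0" using sin_ge[OF y] \<sigma> by linarith
    have "(g has_field_derivative - (1 / 2 + (\<Sum>k=1..N. cos (real k * y)))) (at y within {a..2 * pi - a})"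
      unfolding g_def by (auto intro!: derivative_eq_intros sum.cong)
    also have "- (1 / 2 + (\<Sum>k=1..N. cos (real k * y))) = - (sin (c / 2 * y) / (2 * sin (y / 2)))"
      using dirichlet_kernel[of y N] s by (simp add: c_def field_simps)
    finally have dg: "(g has_field_derivative - (sin (c / 2 * y) / (2 * sin (y / 2)))) (at y within {a..2 * pi - a})" .
    have dq: "((\<lambda>y. cos (c / 2 * y)) has_field_derivative - (sin (c / 2 * y) * c / 2)) (at y within {a..2 * pi - a})"
      by (auto intro!: derivative_eq_intros)
    have ds: "((\<lambda>y. c * sin (y / 2)) has_field_derivative c * cos (y / 2) / 2) (at y within {a..2 * pi - a})"
      by (auto intro!: derivative_eq_intros)
    \<comment> \<open>With variables in place of the trigonometric values, this cancellation is an
      identity of rational functions.\<close>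
    have algebraic: "- (S / (2 * q)) - ((- (S * c / 2)) * (c * q) - C * (c * k / 2)) / (c * q * (c * q))
        = C * k / (2 * c * q\<^sup>2)" if "q > 0" for S C k q :: real
    proof -
      have "((- (S * c / 2)) * (c * q) - C * (c * k / 2)) / (c * q * (c * q))
          = - (S * c / 2 * (c * q) / (c * q * (c * q))) - C * (c * k / 2) / (c * q * (c * q))"
        by (simp add: diff_divide_distrib)
      also have "S * c / 2 * (c * q) / (c * q * (c * q)) = S / (2 * q)"
        using c that by simp
      also have "C * (c * k / 2) / (c * q * (c * q)) = C * k / (2 * c * q\<^sup>2)"
        using c that by (simp add: power2_eq_square)
      finally show ?thesis by simp
    qed
    show ?thesis
      using DERIV_diff[OF dg DERIV_divide[OF dq ds]] s c
      unfolding h_def[abs_def] h'_def algebraic[OF s] by simp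
  qed
  have bd: "\<bar>h' y\<bar> \<le> 1 / (2 * c * \<sigma>\<^sup>2)" if y: "y \<in> {a..2 * pi - a}" for y
  proof -
    have "\<bar>h' y\<bar> = \<bar>cos (c / 2 * y)\<bar> * \<bar>cos (y / 2)\<bar> / (2 * c * (sin (y / 2))\<^sup>2)"
      using c by (simp add: h'_def abs_mult)
    also have "\<dots> \<le> 1 / (2 * c * \<sigma>\<^sup>2)"
      using sin_ge[OF y] c \<sigma> by (intro frac_le mult_le_one mult_left_mono power_mono) auto
    finally show ?thesis .
  qed
  \<comment> \<open>Both parts of \<open>h\<close> vanish at \<open>pi\<close>, the correction
    because \<open>c / 2 * pi\<close> is an odd multiple of \<open>pi / 2\<close>. The mean value
    inequality can thus start at \<open>pi\<close>.\<close>
  have "sin (real k * pi) = 0" for k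
    by simp
  moreover have "cos (c / 2 * pi) = 0"
    by (simp add: c_def add_divide_distrib distrib_right cos_add)
  ultimately have "h pi = 0"
    by (simp add: h_def g_def)
  moreover have "norm (h x - h pi) \<le> 1 / (2 * c * \<sigma>\<^sup>2) * norm (x - pi)"
    by (rule field_differentiable_bound[where S = "{a..2 * pi - a}"]) (use der bd x in auto)
  moreover have "1 / (2 * c * \<sigma>\<^sup>2) * norm (x - pi) \<le> 1 / (2 * c * \<sigma>\<^sup>2) * pi"
    using x a c by (intro mult_left_mono) auto
  ultimately have hb: "\<bar>h x\<bar> \<le> pi / (2 * \<sigma>\<^sup>2) / c"
    by (simp add: field_simps)
  have "\<bar>cos (c / 2 * x) / (c * sin (x / 2))\<bar> = \<bar>cos (c / 2 * x)\<bar> / (c * sin (x / 2))"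
    using c \<sigma> sin_ge[OF x] by (simp add: abs_mult)
  also have "\<dots> \<le> 1 / (c * \<sigma>)"
    using c \<sigma> sin_ge[OF x] by (intro frac_le mult_left_mono) auto
  finally have "\<bar>g x\<bar> \<le> pi / (2 * \<sigma>\<^sup>2) / c + 1 / (c * \<sigma>)"
    using hb unfolding h_def by linarith
  also have "\<dots> = (pi / (2 * \<sigma>\<^sup>2) + 1 / \<sigma>) / c"
    by (simp add: add_divide_distrib mult.commute)
  finally show ?thesis by (simp add: g_def \<sigma>_def c_def)
qed

text \<open>The derivative of \<open>cos_psum N - cos_limit\<close> is the sawtooth error, which is
  \<open>O(1 / N)\<close> uniformly on \<open>{a..2 * pi - a}\<close>; the mean value inequality
  then applies.\<close>

lemma cos_psum_error_diff_tendsto: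
  assumes "x \<in> {0<..<2 * pi}" "y \<in> {0<..<2 * pi}"
  shows "(\<lambda>N. (cos_psum N x - cos_limit x) - (cos_psum N y - cos_limit y)) \<longlonglongrightarrow> 0"
proof -
  \<comment> \<open>The largest \<open>a\<close> for which \<open>{a..2 * pi - a}\<close> contains
    both points.\<close>
  define a where "a = Min {x, y, 2 * pi - x, 2 * pi - y}"
  have a: "0 < a" "x \<in> {a..2 * pi - a}" "y \<in> {a..2 * pi - a}"
    using assms by (auto simp: a_def min_def)
  define K where "K = pi / (2 * (sin (a / 2))\<^sup>2) + 1 / sin (a / 2)"
  have bd: "norm ((cos_psum N x - cos_limit x) - (cos_psum N y - cos_limit y))
          \<le> K / (2 * real N + 1) * norm (x - y)" for N
  proof (rule field_differentiable_bound[where S = "{a..2 * pi - a}"])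
    fix z assume z: "z \<in> {a..2 * pi - a}"
    have dl: "(cos_limit has_field_derivative - ((pi - z) / 2)) (at z within {a..2 * pi - a})"
      unfolding cos_limit_def[abs_def] by (auto intro!: derivative_eq_intros simp: diff_divide_distrib)
    have dp: "(cos_psum N has_field_derivative - (\<Sum>k=1..N. sin (real k * z) / real k)) (at z within {a..2 * pi - a})"
      unfolding cos_psum_def[abs_def]
      by (auto intro!: derivative_eq_intros sum.cong simp: power2_eq_square simp flip: sum_negf)
    show "((\<lambda>z. cos_psum N z - cos_limit z) has_field_derivative
        (pi - z) / 2 - (\<Sum>k=1..N. sin (real k * z) / real k)) (at z within {a..2 * pi - a})"
      using DERIV_diff[OF dp dl] by (simp add: algebra_simps)
    show "norm ((pi - z) / 2 - (\<Sum>k=1..N. sin (real k * z) / real k)) \<le> K / (2 * real N + 1)"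
      using sawtooth_error_bound[OF a(1) z, of N] by (simp add: K_def)
  qed (use a in auto)
  have "((\<lambda>n. 1 / real n) \<circ> (\<lambda>N. 2 * N + 1)) \<longlonglongrightarrow> 0"
    by (intro LIMSEQ_subseq_LIMSEQ lim_1_over_n strict_monoI) auto
  from tendsto_mult_left[OF this, of "K * norm (x - y)"]
  have "(\<lambda>N. K / (2 * real N + 1) * norm (x - y)) \<longlonglongrightarrow> 0"
    by (simp add: o_def add.commute)
  then show ?thesis
    by (rule Lim_null_comparison[rotated]) (use bd in auto)
qed

text \<open>The limiting error \<open>E\<close> is constant on the open interval, hence by
  continuity on the closed one, and the Basel sum gives \<open>E 0 = 0\<close>.\<close>

lemma cos_psum_tendsto:
  assumes "x \<in> {0..2 * pi}"
  shows "(\<lambda>N. cos_psum N x) \<longlonglongrightarrow> cos_limit x"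
proof -
  obtain C where C: "continuous_on UNIV C" "\<And>x. (\<lambda>N. cos_psum N x) \<longlonglongrightarrow> C x"
    using cos_psum_continuous_limit by blast
  define E where "E y = C y - cos_limit y" for y
  have E: "continuous_on {0..2 * pi} E"
    unfolding E_def cos_limit_def
    by (intro continuous_intros continuous_on_subset[OF C(1)]) auto
  have const: "E y = E pi" if "y \<in> {0<..<2 * pi}" for y
  proof -
    have "(\<lambda>N. (cos_psum N y - cos_limit y) - (cos_psum N pi - cos_limit pi)) \<longlonglongrightarrow> E y - E pi"
      unfolding E_def by (intro tendsto_intros C)
    then have "E y - E pi = 0"
      by (rule LIMSEQ_unique) (use that in \<open>intro cos_psum_error_diff_tendsto; simp\<close>)
    then show ?thesis by simp
  qed
  have eq_pi: "E y = E pi" if "y \<in> {0..2 * pi}" for y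
  proof -
    have cl: "closure {0<..<2 * pi} = {0..2 * pi}"
      by (rule closure_greaterThanLessThan) simp
    show ?thesis
      by (rule continuous_constant_on_closure[of "{0<..<2 * pi}" E "E pi" y, unfolded cl]) (fact E const that)+
  qed
  have "E 0 = 0"
    using LIMSEQ_unique[OF C(2) cos_psum_0_tendsto] by (simp add: E_def cos_limit_def)
  then have "E x = 0"
    using eq_pi[OF assms] eq_pi[of 0] by simp
  then show ?thesis using C(2)[of x] by (simp add: E_def)
qed

section \<open>Asymptotics of the tails\<close>

lemma inverse_square_diff_le:
  "(n::nat) \<ge> 1 \<Longrightarrow> 1 / (real (Suc n))\<^sup>2 \<le> 1 / (real n)\<^sup>2"
  by (intro divide_left_mono power_mono) auto

text \<open>The tail is \<open>1 / N\<close> to leading order: adding \<open>1 / N\<close> to the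
  partial sum leaves an error of at most \<open>1 / N\<^sup>2\<close>.\<close>

lemma cos_psum_0_tail:
  "(\<lambda>N. real N * (pi\<^sup>2 / 6 - cos_psum N 0)) \<longlonglongrightarrow> 1"
proof -
  have bd: "\<bar>pi\<^sup>2 / 6 - (cos_psum N 0 + 1 / real N)\<bar> \<le> 1 / (real N)\<^sup>2" if "N \<ge> 1" for N
  proof (rule dist_limit_le_telescope[where m = 1 and u = "\<lambda>N. cos_psum N 0 + 1 / real N" and v = "\<lambda>N. 1 / (real N)\<^sup>2"])
    fix n :: nat assume n: "n \<ge> 1"
    \<comment> \<open>The increment is \<open>- 1 / (n * (n + 1)\<^sup>2)\<close>, expanded to the
      denominator of the telescoping bound, whose numerator is \<open>2 * n + 1\<close>.\<close>
    have "cos_psum (Suc n) 0 + 1 / real (Suc n) - (cos_psum n 0 + 1 / real n)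
        = - (real n / ((real n)\<^sup>2 * (real (Suc n))\<^sup>2))"
      using n by (simp add: cos_psum_def divide_simps) (simp add: algebra_simps power2_eq_square)
    also have "\<bar>\<dots>\<bar> = real n / ((real n)\<^sup>2 * (real (Suc n))\<^sup>2)"
      by simp
    also have "\<dots> \<le> (2 * real n + 1) / ((real n)\<^sup>2 * (real (Suc n))\<^sup>2)"
      by (intro divide_right_mono) auto
    also have "\<dots> = 1 / (real n)\<^sup>2 - 1 / (real (Suc n))\<^sup>2"
      using n by (simp add: divide_simps) (simp add: algebra_simps power2_eq_square)
    finally show "\<bar>cos_psum (Suc n) 0 + 1 / real (Suc n) - (cos_psum n 0 + 1 / real n)\<bar>
        \<le> 1 / (real n)\<^sup>2 - 1 / (real (Suc n))\<^sup>2" .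
  next
    show "(\<lambda>N. cos_psum N 0 + 1 / real N) \<longlonglongrightarrow> pi\<^sup>2 / 6"
      using tendsto_add[OF cos_psum_0_tendsto lim_1_over_n] by simp
  qed (use that tendsto_inverse_square in auto)
  have "(\<lambda>N. real N * (pi\<^sup>2 / 6 - cos_psum N 0) - 1) \<longlonglongrightarrow> 0"
  proof (rule Lim_null_comparison)
    show "\<forall>\<^sub>F N in sequentially. norm (real N * (pi\<^sup>2 / 6 - cos_psum N 0) - 1) \<le> 1 / real N"
      using eventually_ge_at_top[of 1]
    proof eventually_elim
      case (elim N)
      have "real N * (pi\<^sup>2 / 6 - cos_psum N 0) - 1 = real N * (pi\<^sup>2 / 6 - (cos_psum N 0 + 1 / real N))"
        using elim by (simp add: algebra_simps)
      then have "norm (real N * (pi\<^sup>2 / 6 - cos_psum N 0) - 1)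
          = real N * \<bar>pi\<^sup>2 / 6 - (cos_psum N 0 + 1 / real N)\<bar>"
        by (simp add: abs_mult)
      also have "\<dots> \<le> real N * (1 / (real N)\<^sup>2)"
        by (intro mult_left_mono bd elim) auto
      also have "\<dots> = 1 / real N"
        using elim by (simp add: power2_eq_square)
      finally show ?case .
    qed
  qed (rule lim_1_over_n)
  then show ?thesis by (rule LIM_zero_cancel)
qed

lemma cos_psum_tail:
  assumes x: "x \<in> {0<..<2 * pi}"
  shows "(\<lambda>N. real N * (cos_limit x - cos_psum N x)) \<longlonglongrightarrow> 0"
proof -
  define d where "d = 2 * sin (x / 2)"
  have d: "d > 0" unfolding d_def using x by (auto intro!: sin_gt_zero)
  \<comment> \<open>By the Dirichlet kernel, \<open>b n\<close> is \<open>1 / 2\<close> plus the sum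
    of the first \<open>n\<close> cosines: a bounded discrete antiderivative.\<close>
  define b where "b n = sin ((real n + 1 / 2) * x) / d" for n
  have b_le: "\<bar>b n\<bar> \<le> 1 / d" for n
    using d by (simp add: b_def divide_right_mono)
  have b_null: "(\<lambda>n. b n / (real n)\<^sup>2) \<longlonglongrightarrow> 0"
    by (rule Lim_null_comparison[OF _ tendsto_inverse_square[of "1 / d"]])
      (auto intro!: always_eventually simp: abs_divide simp del: divide_divide_eq_left
        intro: divide_right_mono[OF b_le])
  have cos_eq: "cos (real (Suc n) * x) = b (Suc n) - b n" for n
    using dirichlet_kernel[of x n] dirichlet_kernel[of x "Suc n"] d
    by (simp add: b_def d_def field_simps)
  have bd: "\<bar>cos_limit x - (cos_psum N x - b N / (real N)\<^sup>2)\<bar> \<le> (1 / d) / (real N)\<^sup>2" if "N \<ge> 1" for N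
  proof (rule dist_limit_le_telescope[where m = 1 and u = "\<lambda>N. cos_psum N x - b N / (real N)\<^sup>2"
        and v = "\<lambda>N. (1 / d) / (real N)\<^sup>2"])
    fix n :: nat assume n: "n \<ge> 1"
    \<comment> \<open>Once the boundary term of the summation by parts is subtracted, an increment
      is \<open>b n\<close> times the decrease of the weight.\<close>
    have "cos_psum (Suc n) x - b (Suc n) / (real (Suc n))\<^sup>2 - (cos_psum n x - b n / (real n)\<^sup>2)
        = b n * (1 / (real n)\<^sup>2 - 1 / (real (Suc n))\<^sup>2)"
      unfolding cos_psum_def using cos_eq[of n] by (simp add: diff_divide_distrib right_diff_distrib)
    also have "\<bar>\<dots>\<bar> = \<bar>b n\<bar> * (1 / (real n)\<^sup>2 - 1 / (real (Suc n))\<^sup>2)"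
      using inverse_square_diff_le[OF n] by (simp add: abs_mult)
    also have "\<dots> \<le> 1 / d * (1 / (real n)\<^sup>2 - 1 / (real (Suc n))\<^sup>2)"
      using inverse_square_diff_le[OF n] by (intro mult_right_mono b_le) auto
    finally show "\<bar>cos_psum (Suc n) x - b (Suc n) / (real (Suc n))\<^sup>2 - (cos_psum n x - b n / (real n)\<^sup>2)\<bar>
        \<le> (1 / d) / (real n)\<^sup>2 - (1 / d) / (real (Suc n))\<^sup>2"
      by (simp add: right_diff_distrib)
  next
    show "(\<lambda>N. cos_psum N x - b N / (real N)\<^sup>2) \<longlonglongrightarrow> cos_limit x"
      using tendsto_diff[OF cos_psum_tendsto[of x] b_null] x by simp
    show "(\<lambda>N. (1 / d) / (real N)\<^sup>2) \<longlonglongrightarrow> 0"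
      by (rule tendsto_inverse_square)
  qed (rule that)
  show ?thesis
  proof (rule Lim_null_comparison)
    show "\<forall>\<^sub>F N in sequentially. norm (real N * (cos_limit x - cos_psum N x)) \<le> 2 / d * (1 / real N)"
      using eventually_ge_at_top[of 1]
    proof eventually_elim
      case (elim N)
      \<comment> \<open>The boundary term and the remaining error each contribute
        \<open>1 / d\<close>, whence the constant \<open>2 / d\<close>.\<close>
      have "\<bar>b N / (real N)\<^sup>2\<bar> \<le> (1 / d) / (real N)\<^sup>2"
        using divide_right_mono[OF b_le[of N], of "(real N)\<^sup>2"] by simp
      then have "\<bar>cos_limit x - cos_psum N x\<bar> \<le> (1 / d) / (real N)\<^sup>2 + (1 / d) / (real N)\<^sup>2"
        using bd[OF elim] by linarith
      then have "real N * \<bar>cos_limit x - cos_psum N x\<bar> \<le> real N * ((1 / d) / (real N)\<^sup>2 + (1 / d) / (real N)\<^sup>2)"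
        by (intro mult_left_mono) auto
      also have "\<dots> = 2 / d * (1 / real N)"
        using elim d by (simp add: field_simps power2_eq_square)
      finally show ?case by (simp add: abs_mult)
    qed
    have "(\<lambda>N. 2 / d * (1 / real N)) \<longlonglongrightarrow> 2 / d * 0"
      by (intro tendsto_intros lim_1_over_n)
    then show "(\<lambda>N. 2 / d * (1 / real N)) \<longlonglongrightarrow> 0" by simp
  qed
qed

lemma cos_psum_2pi: "cos_psum N (2 * pi) = cos_psum N 0"
proof -
  have "cos (real k * (2 * pi)) = 1" for k
    using cos_int_2pin[of "int k"] by (simp add: mult_ac)
  then show ?thesis by (simp add: cos_psum_def)
qed

text \<open>The endpoint \<open>2 * pi\<close> reduces to \<open>0\<close>, since
  \<open>cos_psum N\<close> and \<open>cos_limit\<close> each take equal values at the two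
  endpoints.\<close>

lemma cos_psum_tail_closed:
  assumes "x \<in> {0..2 * pi}"
  shows "(\<lambda>N. real N * (cos_limit x - cos_psum N x)) \<longlonglongrightarrow> (if x = 0 \<or> x = 2 * pi then 1 else 0)"
proof -
  consider "x = 0" | "x = 2 * pi" | "x \<in> {0<..<2 * pi}" using assms by fastforce
  then show ?thesis
  proof cases
    case 1
    then show ?thesis using cos_psum_0_tail by (simp add: cos_limit_def)
  next
    case 2
    have "cos_limit (2 * pi) = pi\<^sup>2 / 6"
      by (simp add: cos_limit_def power2_eq_square)
    with 2 show ?thesis using cos_psum_0_tail by (simp only: cos_psum_2pi) simp
  next
    case 3
    then show ?thesis using cos_psum_tail by auto
  qed
qed

section \<open>The Brownian bridge kernel as a difference of two cosine series\<close>

theorem theorem1p2: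
  fixes s t :: real
  assumes "s \<in> {0..1}" and "t \<in> {0..1}"
  shows "(\<lambda>N::nat. real N * (min s t - s * t -
            (\<Sum>k=1..N. 2 * sin (real k * pi * s) * sin (real k * pi * t) / ((real k)\<^sup>2 * pi\<^sup>2))))
         \<longlonglongrightarrow> (if s = t \<and> t \<in> {0<..<1} then 1 / pi\<^sup>2 else 0)"
proof -
  \<comment> \<open>Cosine is even, so the absolute value leaves the summands unchanged while
    keeping \<open>x\<close> in \<open>{0..2 * pi}\<close>.\<close>
  define x where "x = pi * \<bar>s - t\<bar>"
  define y where "y = pi * (s + t)"
  have x: "x \<in> {0..2 * pi}" and y: "y \<in> {0..2 * pi}"
    using assms by (auto simp: x_def y_def mult.commute)
  have "2 * sin (real k * pi * s) * sin (real k * pi * t) = cos (real k * x) - cos (real k * y)" for k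
  proof -
    have "cos (real k * x) = cos \<bar>real k * pi * s - real k * pi * t\<bar>"
      by (simp add: x_def abs_mult mult.assoc flip: right_diff_distrib)
    then show ?thesis
      by (simp add: cos_diff y_def distrib_left cos_add mult.assoc)
  qed
  then have sum: "(\<Sum>k=1..N. 2 * sin (real k * pi * s) * sin (real k * pi * t) / ((real k)\<^sup>2 * pi\<^sup>2))
      = (cos_psum N x - cos_psum N y) / pi\<^sup>2" for N
    by (simp add: cos_psum_def diff_divide_distrib sum_subtractf sum_divide_distrib)
  \<comment> \<open>The linear terms give \<open>(s + t - \<bar>s - t\<bar>) / 2 = min s t\<close>,
    the quadratic ones \<open>- s * t\<close>.\<close>
  have "min s t - s * t = (cos_limit x - cos_limit y) / pi\<^sup>2"
    by (simp add: cos_limit_def x_def y_def min_def abs_if field_simps power2_eq_square)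
  then have "real N * (min s t - s * t - (cos_psum N x - cos_psum N y) / pi\<^sup>2)
      = (real N * (cos_limit x - cos_psum N x) - real N * (cos_limit y - cos_psum N y)) / pi\<^sup>2" for N
    by (simp only: diff_divide_distrib right_diff_distrib times_divide_eq_right)
  moreover have "(\<lambda>N. (real N * (cos_limit x - cos_psum N x) - real N * (cos_limit y - cos_psum N y)) / pi\<^sup>2)
      \<longlonglongrightarrow> ((if x = 0 \<or> x = 2 * pi then 1 else 0) - (if y = 0 \<or> y = 2 * pi then 1 else 0)) / pi\<^sup>2"
    by (intro tendsto_intros cos_psum_tail_closed x y) auto
  moreover have "((if x = 0 \<or> x = 2 * pi then 1 else 0) - (if y = 0 \<or> y = 2 * pi then 1 else 0)) / pi\<^sup>2
      = (if s = t \<and> t \<in> {0<..<1} then 1 / pi\<^sup>2 else 0)"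
  proof -
    \<comment> \<open>The \<open>x\<close> tail contributes \<open>1\<close> exactly on the
      diagonal. The \<open>y\<close> tail does so only at the corners \<open>s = t = 0\<close> and
      \<open>s = t = 1\<close>, where the two cancel.\<close>
    have "x = 0 \<longleftrightarrow> s = t" "x \<noteq> 2 * pi"
      using assms by (auto simp: x_def mult.commute)
    moreover have "y = 0 \<longleftrightarrow> s = 0 \<and> t = 0" "y = 2 * pi \<longleftrightarrow> s = 1 \<and> t = 1"
      using assms by (auto simp: y_def mult.commute)
    ultimately show ?thesis using assms by auto
  qed
  ultimately show ?thesis by (simp only: sum)
qed

end
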